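(* Let $k$ be a positive integer. Then there do not exist $\frac{k(k+1)}{2}$ consecutive nonnegative integers $n$ for which $p(n,k)$ is even; that is, any run of consecutive nonnegative integers $n$ with $p(n,k)$ even has length at most $\frac{k(k+1)}{2}-1$.
   Context: For a nonnegative integer $n$ and a positive integer $k$, $p(n,k)$ denotes the number of partitions of $n$ into parts each less than or equal to $k$ (so $p(0,k)=1$); equivalently, $\sum_{n\ge 0} p(n,k)q^n = \prod_{i=1}^{k} \frac{1}{1-q^i}$. *)

theory Defs
  imports "HOL-Library.Multiset"
begin

text \<open>A partition is a finite multiset of positive integers, so that the order of the parts
  is irrelevant. The empty multiset is the only partition of 0.\<close>

definition partitions_le :: "nat \<Rightarrow> nat \<Rightarrow> nat multiset set" where
  "partitions_le n k = {M. (\<forall>x \<in># M. 1 \<le> x \<and> x \<le> k) \<and> sum_mset M = n}"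

definition p :: "nat \<Rightarrow> nat \<Rightarrow> nat" where
  "p n k = card (partitions_le n k)"

lemma size_le_sum_mset:
  fixes M :: "nat multiset"
  assumes "\<forall>x \<in># M. 1 \<le> x"
  shows "size M \<le> sum_mset M"
  using assms by (induction M) auto

text \<open>Finiteness matters here because \<^const>\<open>card\<close> is 0 on infinite sets.\<close>

lemma finite_partitions_le: "finite (partitions_le n k)"
proof (rule finite_subset)
  show "partitions_le n k \<subseteq> mset ` {xs. set xs \<subseteq> {1..k} \<and> length xs \<le> n}"
  proof
    fix M assume M: "M \<in> partitions_le n k"
    obtain xs where xs: "M = mset xs" by (metis ex_mset)
    have "size M \<le> n"
      using M size_le_sum_mset[of M] by (auto simp: partitions_le_def)
    then show "M \<in> mset ` {xs. set xs \<subseteq> {1..k} \<and> length xs \<le> n}"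
      using M xs by (auto simp: partitions_le_def)
  qed
  show "finite (mset ` {xs. set xs \<subseteq> {1..k} \<and> length xs \<le> n})"
    by (intro finite_imageI finite_lists_length_le) simp
qed

lemma p_0: "p 0 k = 1"
proof -
  have "M = {#}" if "M \<in> partitions_le 0 k" for M
    using that by (cases M) (auto simp: partitions_le_def)
  moreover have "{#} \<in> partitions_le 0 k"
    by (simp add: partitions_le_def)
  ultimately have "partitions_le 0 k = {{#}}"
    by blast
  then show ?thesis by (simp add: p_def)
qed

end

theory Submission
  imports Defs
begin

text \<open>Splitting off a part of size k gives p(n + k, k) = p(n + k, k - 1) + p(n, k). If p(n, k) is
  even for k(k+1)/2 consecutive n, then subtracting values at distance k yields
  k(k+1)/2 - k = (k-1)k/2 consecutive even values of p(n, k - 1). Descending on k one reaches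
  an even value of p(n, 1), which is always 1.\<close>

text \<open>Case split on whether \<open>Suc k\<close> occurs: if so, one copy can be removed; if
  not, every part is at most \<open>k\<close>.\<close>

lemma partitions_le_Suc:
  "partitions_le (n + Suc k) (Suc k) =
     partitions_le (n + Suc k) k \<union> add_mset (Suc k) ` partitions_le n (Suc k)"
proof (intro equalityI subsetI)
  fix M assume M: "M \<in> partitions_le (n + Suc k) (Suc k)"
  show "M \<in> partitions_le (n + Suc k) k \<union> add_mset (Suc k) ` partitions_le n (Suc k)"
  proof (cases "Suc k \<in># M")
    case True
    then obtain N where "M = add_mset (Suc k) N"
      by (metis insert_DiffM)
    with M show ?thesis
      by (auto simp: partitions_le_def)
  next
    case False
    with M show ?thesis
      by (auto simp: partitions_le_def le_Suc_eq)
  qed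
qed (auto simp: partitions_le_def le_Suc_eq)

lemma p_add_Suc: "p (n + Suc k) (Suc k) = p (n + Suc k) k + p n (Suc k)"
proof -
  \<comment> \<open>Every multiset in the image contains \<open>Suc k\<close>, which exceeds the
    bound \<open>k\<close> on the parts.\<close>
  have "partitions_le (n + Suc k) k \<inter> add_mset (Suc k) ` partitions_le n (Suc k) = {}"
    by (auto simp: partitions_le_def)
  then have "p (n + Suc k) (Suc k) =
      p (n + Suc k) k + card (add_mset (Suc k) ` partitions_le n (Suc k))"
    by (simp only: p_def partitions_le_Suc card_Un_disjoint finite_partitions_le finite_imageI)
  also have "card (add_mset (Suc k) ` partitions_le n (Suc k)) = p n (Suc k)"
    by (simp add: p_def card_image inj_on_def)
  finally show ?thesis .
qed

text \<open>With this value the recurrence at \<open>k = 0\<close> makes \<open>p n 1\<close>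
  constant in \<open>n\<close>.\<close>

lemma p_Suc_0_right: "p (Suc n) 0 = 0"
proof -
  have "M = {#}" if "M \<in> partitions_le (Suc n) 0" for M
    using that by (cases M) (auto simp: partitions_le_def)
  then have "partitions_le (Suc n) 0 = {}"
    by (auto simp: partitions_le_def)
  then show ?thesis
    by (simp add: p_def)
qed

lemma p_1_right: "p n (Suc 0) = 1"
proof (induction n)
  case 0
  show ?case by (simp add: p_0)
next
  case (Suc n)
  then show ?case
    using p_add_Suc[of n 0] by (simp add: p_Suc_0_right)
qed

text \<open>The descent read upwards: an odd value for \<open>k\<close> is lifted to one for
  \<open>Suc k\<close>. The start \<open>m\<close> stays arbitrary because the induction hypothesis
  is applied to a shifted window.\<close>

lemma exists_odd_p:
  assumes "k > 0"
  shows "\<exists>n \<in> {m..<m + (k * (k + 1)) div 2}. odd (p n k)"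
  using assms
proof (induction k arbitrary: m rule: nat_induct_non_zero)
  case 1
  show ?case by (simp add: p_1_right)
next
  case (Suc k)
  have length: "(Suc k * (Suc k + 1)) div 2 = (k * (k + 1)) div 2 + Suc k"
    by simp
  \<comment> \<open>Starting at \<open>m + Suc k\<close> ensures that \<open>n' - Suc k\<close> is
    not truncated and is still at least \<open>m\<close>.\<close>
  obtain n' where n': "n' \<in> {m + Suc k..<m + Suc k + (k * (k + 1)) div 2}" "odd (p n' k)"
    using Suc.IH by blast
  define n where "n = n' - Suc k"
  have n: "n' = n + Suc k"
    using n' by (simp add: n_def)
  \<comment> \<open>These two values differ by the odd number \<open>p n' k\<close>, so they have
    opposite parity.\<close>
  have "odd (p (n + Suc k) (Suc k)) \<or> odd (p n (Suc k))"
    using n'(2) p_add_Suc[of n k] unfolding n by presburger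
  moreover have "n \<in> {m..<m + (Suc k * (Suc k + 1)) div 2}"
      "n + Suc k \<in> {m..<m + (Suc k * (Suc k + 1)) div 2}"
    using n'(1) unfolding n length by auto
  ultimately show ?case by blast
qed

theorem theorem4p1:
  fixes k :: nat
  assumes "k > 0"
  shows "(\<nexists>m::nat. \<forall>n \<in> {m..<m + (k * (k + 1)) div 2}. even (p n k)) \<and>
         (\<forall>(m::nat) (l::nat). (\<forall>n \<in> {m..<m + l}. even (p n k)) \<longrightarrow>
            l \<le> (k * (k + 1)) div 2 - 1)"
proof (intro conjI allI impI)
  show "\<nexists>m::nat. \<forall>n \<in> {m..<m + (k * (k + 1)) div 2}. even (p n k)"
    using exists_odd_p[OF assms] by blast
next
  fix m l :: nat
  assume even: "\<forall>n \<in> {m..<m + l}. even (p n k)"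
  obtain n where "n \<in> {m..<m + (k * (k + 1)) div 2}" "odd (p n k)"
    using exists_odd_p[OF assms] by blast
  \<comment> \<open>The odd value lies at or after \<open>m\<close>, so a run of even values from
    \<open>m\<close> must stop before it.\<close>
  with even have "m + l \<le> n" "n < m + (k * (k + 1)) div 2"
    by (auto simp: not_less[symmetric])
  then show "l \<le> (k * (k + 1)) div 2 - 1"
    by linarith
qed

end
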